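(* Let $K,L\in\mathcal{K}^n$, let $i$ be an integer with $0\le i<n$, and let $p\ge1$. Then $$A_{-p,i}(K,L)^{n-i}\ge A_i(K)^{n-i+p}A_i(L)^{-p},$$ with equality if and only if $K$ and $L$ have similar width.
   Context: $\mathcal{K}^n$ is the class of convex bodies (compact convex sets with nonempty interior) in $\mathbb{R}^n$ containing the origin in their interiors. The support function is $h(K,x)=\max\{x\cdot y:y\in K\}$, and the half width of $K$ in direction $u\in S^{n-1}$ is $b(K,u)=\frac12(h(K,u)+h(K,-u))$. $K$ and $L$ have similar width if there is a constant $\lambda>0$ with $b(K,u)=\lambda b(L,u)$ for all $u\in S^{n-1}$. $dS$ is the surface area measure on the unit sphere $S^{n-1}$. For an integer $0\le i<n$ the width integral is $A_i(K)=\frac1n\int_{S^{n-1}}b(K,u)^{n-i}\,dS(u)$, and for $p\ge1$ the $L_p$-mixed width integral is $$A_{-p,i}(K,L)=\frac1n\int_{S^{n-1}}b(K,u)^{n-i+p}\,b(L,u)^{-p}\,dS(u).$$ *)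

theory Defs
  imports "HOL-Analysis.Analysis"
begin

definition convex_bodies_origin :: "'a::euclidean_space set set" where
  "convex_bodies_origin =
     {K. compact K \<and> convex K \<and> interior K \<noteq> {} \<and> 0 \<in> interior K}"

text \<open>The supremum below is the maximum for nonempty compact \<open>K\<close>; see \<open>support_fun_is_max\<close>.\<close>

definition support_fun :: "'a::euclidean_space set \<Rightarrow> 'a \<Rightarrow> real" where
  "support_fun K x = (SUP y\<in>K. x \<bullet> y)"

definition half_width :: "'a::euclidean_space set \<Rightarrow> 'a \<Rightarrow> real" where
  "half_width K u = (support_fun K u + support_fun K (- u)) / 2"

definition similar_width :: "'a::euclidean_space set \<Rightarrow> 'a set \<Rightarrow> bool" where
  "similar_width K L \<longleftrightarrow>
     (\<exists>c>0. \<forall>u\<in>sphere 0 1. half_width K u = c * half_width L u)"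

text \<open>
  Surface area measure on the unit sphere, normalised by polar coordinates: the measure of a
  Borel set \<open>B\<close> of the sphere is \<open>n\<close> times the volume of the cone
  \<open>{t *\<^sub>R u | t u. 0 < t \<le> 1 \<and> u \<in> B}\<close>, see \<open>emeasure_sphere_measure\<close>. In particular
  the total mass is \<open>n\<close> times the volume of the unit ball.
\<close>

definition sphere_measure :: "'a::euclidean_space measure" where
  "sphere_measure =
     scale_measure (of_nat DIM('a))
       (distr (restrict_space lborel (cball 0 1 - {0}))
              (restrict_space borel (sphere 0 1))
              (\<lambda>x. x /\<^sub>R norm x))"

text \<open>The truncated subtraction \<open>DIM('a) - i\<close> is only meaningful for \<open>i \<le> DIM('a)\<close>.\<close>

definition width_integral :: "nat \<Rightarrow> 'a::euclidean_space set \<Rightarrow> real" where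
  "width_integral i K =
     1 / real DIM('a) * (\<integral>u. half_width K u ^ (DIM('a) - i) \<partial>(sphere_measure :: 'a measure))"

definition Lp_mixed_width_integral ::
    "real \<Rightarrow> nat \<Rightarrow> 'a::euclidean_space set \<Rightarrow> 'a set \<Rightarrow> real" where
  "Lp_mixed_width_integral p i K L =
     1 / real DIM('a) *
       (\<integral>u. half_width K u powr (real DIM('a) - real i + p) * half_width L u powr (- p)
          \<partial>(sphere_measure :: 'a measure))"

lemma support_fun_is_max:
  fixes K :: "'a::euclidean_space set"
  assumes "compact K" "K \<noteq> {}"
  shows "\<exists>y\<in>K. support_fun K x = x \<bullet> y \<and> (\<forall>z\<in>K. x \<bullet> z \<le> x \<bullet> y)"
proof -
  have "continuous_on K (\<lambda>y. x \<bullet> y)"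
    by (intro continuous_intros)
  then obtain y where y: "y \<in> K" "\<forall>z\<in>K. x \<bullet> z \<le> x \<bullet> y"
    using continuous_attains_sup[OF assms] by blast
  have "support_fun K x = x \<bullet> y"
    unfolding support_fun_def using y by (intro cSup_eq_maximum) auto
  with y show ?thesis by blast
qed

lemma space_sphere_measure: "space sphere_measure = sphere 0 1"
  by (simp add: sphere_measure_def space_scale_measure space_restrict_space)

lemma sets_sphere_measure: "sets sphere_measure = sets (restrict_space borel (sphere 0 1))"
  by (simp add: sphere_measure_def)

lemma emeasure_sphere_measure:
  fixes B :: "'a::euclidean_space set"
  assumes "B \<in> sets borel" "B \<subseteq> sphere 0 1"
  shows "emeasure sphere_measure B =
           of_nat DIM('a) * emeasure lborel {t *\<^sub>R u | t u. 0 < t \<and> t \<le> 1 \<and> u \<in> B}"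
proof -
  let ?D = "cball 0 1 - {0 :: 'a}"
  let ?f = "\<lambda>x::'a. x /\<^sub>R norm x"
  have D: "?D \<in> sets borel" by auto
  have B: "B \<in> sets (restrict_space borel (sphere 0 1))"
    using assms by (auto simp: sets_restrict_space_iff)
  have "?f \<in> measurable (restrict_space lborel ?D) borel"
    by (intro measurable_restrict_space1) measurable
  then have f: "?f \<in> measurable (restrict_space lborel ?D) (restrict_space borel (sphere 0 1))"
    by (intro measurable_restrict_space2) (auto simp: space_restrict_space)
  have cone: "?f -` B \<inter> ?D = {t *\<^sub>R u | t u. 0 < t \<and> t \<le> 1 \<and> u \<in> B}"
  proof (intro equalityI subsetI)
    fix x assume x: "x \<in> ?f -` B \<inter> ?D"
    then have "x = norm x *\<^sub>R ?f x" "0 < norm x" "norm x \<le> 1" "?f x \<in> B"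
      by auto
    then show "x \<in> {t *\<^sub>R u | t u. 0 < t \<and> t \<le> 1 \<and> u \<in> B}" by blast
  next
    fix x assume "x \<in> {t *\<^sub>R u | t u. 0 < t \<and> t \<le> 1 \<and> u \<in> B}"
    then obtain t u where tu: "x = t *\<^sub>R u" "0 < t" "t \<le> 1" "u \<in> B" by blast
    then have "norm u = 1" using assms by auto
    with tu show "x \<in> ?f -` B \<inter> ?D" by auto
  qed
  have "emeasure sphere_measure B =
          of_nat DIM('a) * emeasure (restrict_space lborel ?D) (?f -` B \<inter> ?D)"
    using emeasure_distr[OF f B] by (simp add: sphere_measure_def space_restrict_space)
  also have "emeasure (restrict_space lborel ?D) (?f -` B \<inter> ?D) = emeasure lborel (?f -` B \<inter> ?D)"
    using D by (intro emeasure_restrict_space) auto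
  finally show ?thesis unfolding cone .
qed

end

theory Submission
  imports Defs
begin

text \<open>
  With \<open>m = n - i\<close>, \<open>a = b(K,\<cdot>)^m\<close>, \<open>c = b(L,\<cdot>)^m\<close> and \<open>q = (m + p) / m > 1\<close>, the claim is the
  \<open>m\<close>-th power of Radon's inequality \<open>(\<integral>a)^q (\<integral>c)^(1-q) \<le> \<integral> a^q c^(1-q)\<close>.  Radon's inequality in
  turn is the tangent line inequality for \<open>y^q\<close> at \<open>t = \<integral>a / \<integral>c\<close>, taken at \<open>y = a/c\<close>, multiplied
  by \<open>c\<close> and integrated.  Equality forces \<open>a = t c\<close> almost everywhere, hence everywhere on the
  sphere, because \<open>a\<close> and \<open>c\<close> are continuous and nonempty open subsets of the sphere have positive
  measure.
\<close>

section \<open>Tangent line inequalities for real powers\<close>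

text \<open>By the mean value theorem between \<open>1\<close> and \<open>y\<close>, the slope of
  the chord is \<open>q * z powr (q - 1)\<close>, which lies strictly above \<open>q\<close> for
  \<open>y > 1\<close> and strictly below for \<open>y < 1\<close>. The strictness is what settles
  equality cases.\<close>

lemma powr_tangent_strict:
  fixes y q :: real
  assumes "y > 0" "q > 1" "y \<noteq> 1"
  shows "1 + q * (y - 1) < y powr q"
proof (cases "y > 1")
  case True
  have "((\<lambda>x. x powr q) has_real_derivative q * x powr (q - 1)) (at x)" if "1 \<le> x" for x
    using that by (auto intro!: derivative_eq_intros)
  then obtain z where z: "1 < z" "z < y" "y powr q - 1 powr q = (y - 1) * (q * z powr (q - 1))"
    using MVT2[of 1 y "\<lambda>x. x powr q" "\<lambda>x. q * x powr (q - 1)"] True by blast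
  have "z powr (q - 1) > 1"
    using z assms by (simp add: gr_one_powr)
  then have "(y - 1) * q * 1 < (y - 1) * q * z powr (q - 1)"
    using True assms by (intro mult_strict_left_mono) auto
  then show ?thesis using z(3) by (simp add: algebra_simps)
next
  case False
  then have "y < 1" using assms by simp
  have "((\<lambda>x. x powr q) has_real_derivative q * x powr (q - 1)) (at x)" if "y \<le> x" for x
    using that assms by (auto intro!: derivative_eq_intros)
  then obtain z where z: "y < z" "z < 1" "1 powr q - y powr q = (1 - y) * (q * z powr (q - 1))"
    using MVT2[of y 1 "\<lambda>x. x powr q" "\<lambda>x. q * x powr (q - 1)"] \<open>y < 1\<close> by blast
  have "z powr (q - 1) < 1"
    using powr_less_mono2[of "q - 1" z 1] z assms by simp
  then have "(1 - y) * q * z powr (q - 1) < (1 - y) * q * 1"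
    using \<open>y < 1\<close> assms by (intro mult_strict_left_mono) auto
  then show ?thesis using z(3) by (simp add: algebra_simps)
qed

text \<open>For fixed \<open>t\<close> the left side is linear in \<open>a\<close> and
  \<open>c\<close>, so it can be integrated termwise. With \<open>y = a / (t * c)\<close> both sides
  carry the positive factor \<open>w = c * t powr q\<close>, which reduces the claim to the tangent
  to \<open>y powr q\<close> at \<open>1\<close>.\<close>

lemma powr_perspective_tangent:
  fixes a c t q :: real
  assumes "a > 0" "c > 0" "t > 0" "q > 1"
  shows "c * t powr q + q * t powr (q - 1) * (a - t * c) \<le> a powr q * c powr (1 - q)"
    and "c * t powr q + q * t powr (q - 1) * (a - t * c) = a powr q * c powr (1 - q)
           \<longleftrightarrow> a = t * c"
proof -
  define y where "y = a / (t * c)"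
  define w where "w = c * t powr q"
  have y: "y > 0" and w: "w > 0" using assms by (auto simp: y_def w_def)
  have a: "a = y * (t * c)" using assms by (simp add: y_def)
  have "t powr q = t * t powr (q - 1)"
    using assms by (simp add: powr_diff)
  then have lhs: "c * t powr q + q * t powr (q - 1) * (a - t * c) = w * (1 + q * (y - 1))"
    by (simp add: w_def a algebra_simps)
  have "c powr q * c powr (1 - q) = c"
    using assms by (simp flip: powr_add)
  then have rhs: "a powr q * c powr (1 - q) = w * y powr q"
    using assms y by (simp add: w_def a powr_mult)
  have eq1: "a = t * c \<longleftrightarrow> y = 1"
    using assms by (auto simp: y_def)
  have lt: "1 + q * (y - 1) < y powr q" if "y \<noteq> 1"
    using powr_tangent_strict[OF y assms(4) that] .
  show "c * t powr q + q * t powr (q - 1) * (a - t * c) \<le> a powr q * c powr (1 - q)"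
    unfolding lhs rhs using lt w by (cases "y = 1") (auto intro!: mult_left_mono)
  show "c * t powr q + q * t powr (q - 1) * (a - t * c) = a powr q * c powr (1 - q)
           \<longleftrightarrow> a = t * c"
    unfolding lhs rhs eq1 using lt w by (cases "y = 1") auto
qed

section \<open>Radon's inequality for integrals\<close>

text \<open>A vanishing integral would force \<open>f = 0\<close> almost everywhere; since
  \<open>f\<close> is positive on all of \<open>space M\<close>, the whole space would be a null
  set.\<close>

lemma integral_pos:
  fixes f :: "'b \<Rightarrow> real"
  assumes f: "integrable M f" "\<And>x. x \<in> space M \<Longrightarrow> f x > 0"
    and M: "emeasure M (space M) \<noteq> 0"
  shows "(\<integral>x. f x \<partial>M) > 0"
proof -
  have nonneg: "AE x in M. 0 \<le> f x"
    using f(2) by (intro AE_I2) (simp add: less_imp_le)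
  have "(\<integral>x. f x \<partial>M) \<noteq> 0"
  proof
    assume "(\<integral>x. f x \<partial>M) = 0"
    then have "AE x in M. f x = 0"
      using integral_nonneg_eq_0_iff_AE[OF f(1) nonneg] by simp
    then have "AE x in M. x \<notin> space M"
      by (rule AE_mp) (use f(2) in \<open>fastforce intro!: AE_I2\<close>)
    then show False
      using M AE_iff_null_sets[of "space M" M] by auto
  qed
  then show ?thesis using integral_nonneg_AE[OF nonneg] by simp
qed

lemma Radon_inequality_integral:
  fixes a c :: "'b \<Rightarrow> real" and q :: real
  assumes a: "integrable M a" "\<And>x. x \<in> space M \<Longrightarrow> a x > 0"
    and c: "integrable M c" "\<And>x. x \<in> space M \<Longrightarrow> c x > 0"
    and ac: "integrable M (\<lambda>x. a x powr q * c x powr (1 - q))"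
    and q: "q > 1" and M: "emeasure M (space M) \<noteq> 0"
  shows "(\<integral>x. a x \<partial>M) powr q * (\<integral>x. c x \<partial>M) powr (1 - q)
           \<le> (\<integral>x. a x powr q * c x powr (1 - q) \<partial>M)"
    and "(\<integral>x. a x powr q * c x powr (1 - q) \<partial>M)
             = (\<integral>x. a x \<partial>M) powr q * (\<integral>x. c x \<partial>M) powr (1 - q)
           \<longleftrightarrow> (AE x in M. a x = (\<integral>x. a x \<partial>M) / (\<integral>x. c x \<partial>M) * c x)"
proof -
  let ?I = "\<integral>x. a x powr q * c x powr (1 - q) \<partial>M"
  let ?R = "(\<integral>x. a x \<partial>M) powr q * (\<integral>x. c x \<partial>M) powr (1 - q)"
  define A where "A = (\<integral>x. a x \<partial>M)"
  define C where "C = (\<integral>x. c x \<partial>M)"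
  define t where "t = A / C"
  have A: "A > 0"
    unfolding A_def by (rule integral_pos[OF a M])
  have C: "C > 0"
    unfolding C_def by (rule integral_pos[OF c M])
  have t: "t > 0" using A C by (simp add: t_def)
  define g where "g x = c x * t powr q + q * t powr (q - 1) * (a x - t * c x)" for x
  \<comment> \<open>\<open>d\<close> is the pointwise gap above the tangent. It is nonnegative and
    its integral is the gap in Radon's inequality, so equality there means \<open>d = 0\<close>
    almost everywhere.\<close>
  define d where "d x = a x powr q * c x powr (1 - q) - g x" for x
  have g: "integrable M g"
    unfolding g_def using a c by auto
  \<comment> \<open>The choice \<open>t = A / C\<close> makes \<open>A - t * C\<close> vanish, and
    the remaining term \<open>C * t powr q\<close> equals
    \<open>A powr q * C powr (1 - q)\<close>.\<close>
  have "(\<integral>x. g x \<partial>M) = C * t powr q + q * t powr (q - 1) * (A - t * C)"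
    unfolding g_def A_def C_def using a c by simp
  also have "\<dots> = ?R"
    using A C by (simp add: t_def powr_divide powr_diff flip: A_def C_def)
  finally have int_g: "(\<integral>x. g x \<partial>M) = ?R" .
  have d: "integrable M d" unfolding d_def using ac g by simp
  have int_d: "(\<integral>x. d x \<partial>M) = ?I - ?R"
    unfolding d_def using ac g int_g by simp
  have d_nonneg: "d x \<ge> 0" if "x \<in> space M" for x
    using powr_perspective_tangent(1)[OF a(2) c(2) t q, OF that that] by (simp add: d_def g_def)
  have d_zero: "d x = 0 \<longleftrightarrow> a x = t * c x" if "x \<in> space M" for x
    using powr_perspective_tangent(2)[OF a(2) c(2) t q, OF that that] by (auto simp: d_def g_def)
  have "(\<integral>x. d x \<partial>M) \<ge> 0"
    using d_nonneg by (intro integral_nonneg_AE) auto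
  then show "?R \<le> ?I" using int_d by simp
  have "?I = ?R \<longleftrightarrow> (\<integral>x. d x \<partial>M) = 0" using int_d by auto
  also have "\<dots> \<longleftrightarrow> (AE x in M. d x = 0)"
    using d d_nonneg by (intro integral_nonneg_eq_0_iff_AE) auto
  also have "\<dots> \<longleftrightarrow> (AE x in M. a x = t * c x)"
    using d_zero by (intro AE_cong) auto
  finally show "?I = ?R \<longleftrightarrow> (AE x in M. a x = (\<integral>x. a x \<partial>M) / (\<integral>x. c x \<partial>M) * c x)"
    by (simp add: t_def A_def C_def)
qed

section \<open>Surface measure of the sphere: open sets, finiteness, continuous integrands\<close>

text \<open>The cone \<open>V\<close> over the set contains a nonempty open subset \<open>U\<close>
  of the ambient space, hence has positive Lebesgue measure.\<close>

lemma emeasure_sphere_measure_open_pos: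
  fixes T :: "'a::euclidean_space set"
  assumes T: "open T" and u: "u \<in> sphere 0 1" "u \<in> T"
  shows "emeasure sphere_measure (sphere 0 1 \<inter> T) > 0"
proof -
  \<comment> \<open>The open ball makes \<open>U\<close> open; the origin is removed because radial
    projection is discontinuous there. As \<open>u\<close> lies on the boundary of the ball,
    \<open>u /\<^sub>R 2\<close> serves as the point of \<open>U\<close>.\<close>
  define U where "U = (ball 0 1 - {0}) \<inter> (\<lambda>x::'a. x /\<^sub>R norm x) -` T"
  define V where "V = {t *\<^sub>R v | t v. 0 < t \<and> t \<le> 1 \<and> v \<in> sphere 0 1 \<inter> T}"
  have "continuous_on (ball 0 1 - {0}) (\<lambda>x::'a. x /\<^sub>R norm x)"
    by (intro continuous_intros) auto
  then have "open U"
    unfolding U_def by (intro continuous_open_preimage T) auto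
  moreover have "u /\<^sub>R 2 \<in> U"
    using u by (auto simp: U_def)
  ultimately have "U \<notin> null_sets lborel"
    using open_not_negligible[of U] null_sets_completionI[of U lborel]
    by (auto simp: negligible_iff_null_sets)
  have V: "V = (cball 0 1 - {0}) \<inter> (\<lambda>x::'a. x /\<^sub>R norm x) -` T"
  proof (intro equalityI subsetI)
    fix x assume "x \<in> (cball 0 1 - {0}) \<inter> (\<lambda>x::'a. x /\<^sub>R norm x) -` T"
    then have "x = norm x *\<^sub>R (x /\<^sub>R norm x)" "0 < norm x" "norm x \<le> 1"
      "x /\<^sub>R norm x \<in> sphere 0 1 \<inter> T"
      by auto
    then show "x \<in> V" unfolding V_def by blast
  qed (auto simp: V_def)
  have "(\<lambda>x::'a. x /\<^sub>R norm x) -` T \<in> sets borel"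
    using T by (intro measurable_sets_borel[of _ borel]) auto
  then have "V \<in> sets borel"
    unfolding V by auto
  moreover have "U \<subseteq> V"
    unfolding U_def V by auto
  ultimately have "emeasure lborel U \<le> emeasure lborel V"
    by (intro emeasure_mono) auto
  moreover have "emeasure lborel U \<noteq> 0"
    using \<open>U \<notin> null_sets lborel\<close> \<open>open U\<close> by auto
  ultimately have "emeasure lborel V \<noteq> 0"
    by auto
  moreover have "emeasure sphere_measure (sphere 0 1 \<inter> T) = of_nat DIM('a) * emeasure lborel V"
    unfolding V_def using T by (intro emeasure_sphere_measure) auto
  ultimately show ?thesis by (simp add: zero_less_iff_neq_zero)
qed

text \<open>The set where \<open>f\<close> and \<open>g\<close> differ is relatively open in the
  sphere, so if it contained \<open>u\<close> it would have positive measure.\<close>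

lemma AE_sphere_measure_continuous_eq:
  fixes f g :: "'a::euclidean_space \<Rightarrow> real"
  assumes f: "continuous_on (sphere 0 1) f" and g: "continuous_on (sphere 0 1) g"
    and ae: "AE x in sphere_measure. f x = g x" and u: "u \<in> sphere 0 1"
  shows "f u = g u"
proof (rule ccontr)
  assume ne: "f u \<noteq> g u"
  have "continuous_on (sphere 0 1) (\<lambda>x. f x - g x)"
    using f g by (intro continuous_intros)
  then obtain T where T: "open T" "T \<inter> sphere 0 1 = (\<lambda>x. f x - g x) -` (- {0}) \<inter> sphere 0 1"
    unfolding continuous_on_open_invariant by (meson open_delete open_UNIV open_Compl closed_singleton)
  have "AE x in sphere_measure. x \<notin> sphere 0 1 \<inter> T"
    using ae by eventually_elim (use T(2) in auto)
  moreover have "sphere 0 1 \<inter> T \<in> sets sphere_measure"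
    using T(1) by (auto simp: sets_sphere_measure sets_restrict_space_iff)
  ultimately have "emeasure sphere_measure (sphere 0 1 \<inter> T) = 0"
    by (simp add: AE_iff_measurable[of _ sphere_measure] AE_iff_null_sets null_setsD1)
  moreover have "u \<in> T" using T(2) u ne by auto
  ultimately show False
    using emeasure_sphere_measure_open_pos[OF T(1) u] by simp
qed

lemma emeasure_sphere_measure_space_pos:
  "emeasure (sphere_measure :: 'a::euclidean_space measure) (space sphere_measure) \<noteq> 0"
proof -
  obtain u :: 'a where "norm u = 1" using vector_choose_size[of 1] zero_le_one by metis
  then show ?thesis
    using emeasure_sphere_measure_open_pos[of UNIV u] by (simp add: space_sphere_measure)
qed

text \<open>The cone over the whole sphere lies in the closed unit ball, whose volume is
  finite.\<close>

lemma finite_measure_sphere_measure: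
  "finite_measure (sphere_measure :: 'a::euclidean_space measure)"
proof
  define V where "V = {t *\<^sub>R u | t (u :: 'a). 0 < t \<and> t \<le> 1 \<and> u \<in> sphere 0 1}"
  have "emeasure (sphere_measure :: 'a measure) (sphere 0 1) = of_nat DIM('a) * emeasure lborel V"
    unfolding V_def by (rule emeasure_sphere_measure) auto
  also have "\<dots> \<le> of_nat DIM('a) * emeasure lborel (cball (0::'a) 1)"
    by (intro mult_left_mono emeasure_mono) (auto simp: V_def)
  also have "\<dots> < \<infinity>"
    using emeasure_lborel_cball_finite[of "0::'a" 1]
    by (simp add: ennreal_mult_less_top of_nat_less_top)
  finally show "emeasure (sphere_measure :: 'a measure) (space sphere_measure) \<noteq> \<infinity>"
    by (simp add: space_sphere_measure)
qed

lemma integrable_sphere_measure_continuous: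
  fixes f :: "'a::euclidean_space \<Rightarrow> real"
  assumes f: "continuous_on (sphere 0 1) f"
  shows "integrable sphere_measure f"
proof -
  interpret finite_measure "sphere_measure :: 'a measure"
    by (rule finite_measure_sphere_measure)
  have "bounded (f ` sphere 0 1)"
    using f by (intro compact_imp_bounded compact_continuous_image) auto
  then obtain B where B: "\<And>x. x \<in> sphere 0 1 \<Longrightarrow> norm (f x) \<le> B"
    unfolding bounded_iff by blast
  have "f \<in> borel_measurable (restrict_space borel (sphere 0 1))"
    using f by (rule borel_measurable_continuous_on_restrict)
  then have "f \<in> borel_measurable sphere_measure"
    by (simp add: sets_sphere_measure cong: measurable_cong_sets)
  moreover have "AE x in sphere_measure. norm (f x) \<le> B"
    using B by (intro AE_I2) (simp add: space_sphere_measure)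
  ultimately show ?thesis by (intro integrable_const_bound)
qed

section \<open>Continuity and positivity of support functions and half widths\<close>

text \<open>A maximiser \<open>z\<close> for the combined direction is a competitor for both
  \<open>x\<close> and \<open>y\<close>. Convexity is wanted because a finite convex function on the
  whole space is continuous.\<close>

lemma convex_on_support_fun:
  assumes K: "compact K" "K \<noteq> {}"
  shows "convex_on UNIV (support_fun K)"
proof (rule convex_onI)
  fix t :: real and x y :: 'a
  assume t: "0 < t" "t < 1"
  obtain z where z: "z \<in> K"
    "support_fun K ((1 - t) *\<^sub>R x + t *\<^sub>R y) = ((1 - t) *\<^sub>R x + t *\<^sub>R y) \<bullet> z"
    using support_fun_is_max[OF K] by blast
  have le: "w \<bullet> z \<le> support_fun K w" for w
    using support_fun_is_max[OF K, of w] z(1) by auto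
  have "(1 - t) * (x \<bullet> z) + t * (y \<bullet> z) \<le> (1 - t) * support_fun K x + t * support_fun K y"
    using t le by (intro add_mono mult_left_mono) auto
  then show "support_fun K ((1 - t) *\<^sub>R x + t *\<^sub>R y)
      \<le> (1 - t) * support_fun K x + t * support_fun K y"
    by (simp add: z(2) inner_add_left)
qed auto

lemma continuous_on_half_width:
  assumes "compact K" "K \<noteq> {}"
  shows "continuous_on S (half_width K)"
proof -
  have "continuous_on UNIV (support_fun K)"
    using convex_on_support_fun[OF assms] by (intro convex_on_continuous) auto
  then have *: "continuous_on S (\<lambda>u. support_fun K (g u))" if "continuous_on S g" for g
    using that by (rule continuous_on_compose2) auto
  show ?thesis
    unfolding half_width_def by (intro continuous_intros *) auto
qed

text \<open>Some ball around the origin lies in \<open>K\<close>, and its boundary point in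
  direction \<open>u\<close> has positive inner product with \<open>u\<close>.\<close>

lemma support_fun_pos:
  assumes K: "compact K" and 0: "0 \<in> interior K" and u: "u \<noteq> 0"
  shows "support_fun K u > 0"
proof -
  obtain e where e: "e > 0" "cball 0 e \<subseteq> K"
    using 0 by (auto simp: mem_interior_cball)
  define z where "z = (e / norm u) *\<^sub>R u"
  have "z \<in> K" using e u by (intro subsetD[OF e(2)]) (simp add: z_def)
  then have "u \<bullet> z \<le> support_fun K u"
    using support_fun_is_max[OF K, of u] by fastforce
  moreover have "u \<bullet> z > 0" using e u by (simp add: z_def)
  ultimately show ?thesis by simp
qed

lemma half_width_pos:
  assumes "compact K" "0 \<in> interior K" "u \<noteq> 0"
  shows "half_width K u > 0"
  using support_fun_pos[OF assms] support_fun_pos[OF assms(1,2), of "- u"] assms(3)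
  by (simp add: half_width_def)

section \<open>The inequality for width integrals and its equality case\<close>

theorem proposition2p2:
  fixes K L :: "'a::euclidean_space set" and i :: nat and p :: real
  assumes "K \<in> convex_bodies_origin" and "L \<in> convex_bodies_origin"
    and "i < DIM('a)" and "p \<ge> 1"
  shows "Lp_mixed_width_integral p i K L ^ (DIM('a) - i)
           \<ge> width_integral i K powr (real DIM('a) - real i + p) * width_integral i L powr (- p)
         \<and> (Lp_mixed_width_integral p i K L ^ (DIM('a) - i)
              = width_integral i K powr (real DIM('a) - real i + p) * width_integral i L powr (- p)
            \<longleftrightarrow> similar_width K L)"
proof -
  let ?S = "sphere_measure :: 'a measure"
  define n where "n = real DIM('a)"
  have nz: "u \<noteq> 0" if "u \<in> sphere 0 1" for u :: 'a using that by auto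
  define m where "m = DIM('a) - i"
  \<comment> \<open>This exponent turns \<open>a u powr q\<close> and
    \<open>c u powr (1 - q)\<close> into the powers \<open>real m + p\<close> and \<open>- p\<close>
    of the half widths.\<close>
  define q where "q = (real m + p) / real m"
  have m: "m > 0" and mr: "real DIM('a) - real i = real m" and n: "n > 0"
    using assms(3) by (auto simp: m_def n_def)
  have q: "q > 1" and mq: "real m * q = real m + p" "real m * (1 - q) = - p"
    using m assms(4) by (auto simp: q_def field_simps)
  have K: "compact K" "0 \<in> interior K" "K \<noteq> {}" and L: "compact L" "0 \<in> interior L" "L \<noteq> {}"
    using assms(1,2) interior_subset by (auto simp: convex_bodies_origin_def)
  define a where "a u = half_width K u ^ m" for u
  define c where "c u = half_width L u ^ m" for u
  have pos: "half_width K u > 0" "half_width L u > 0" if "u \<in> sphere 0 1" for u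
    by (rule half_width_pos[OF K(1,2) nz[OF that]], rule half_width_pos[OF L(1,2) nz[OF that]])
  have ac_pos: "a u > 0" "c u > 0" if "u \<in> sphere 0 1" for u
    using pos[OF that] by (auto simp: a_def c_def)
  have ac_powr: "a u powr q * c u powr (1 - q)
      = half_width K u powr (real m + p) * half_width L u powr (- p)" if "u \<in> sphere 0 1" for u
    using pos[OF that] by (simp add: a_def c_def powr_powr mq flip: powr_realpow)
  have cont: "continuous_on (sphere 0 1) a" "continuous_on (sphere 0 1) c"
    unfolding a_def c_def
    using continuous_on_half_width[OF K(1,3)] continuous_on_half_width[OF L(1,3)]
    by (auto intro!: continuous_intros)
  \<comment> \<open>Positivity keeps both bases away from \<open>0\<close>, as continuity of
    \<open>powr\<close> with a possibly negative exponent requires.\<close>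
  then have "continuous_on (sphere 0 1) (\<lambda>u. a u powr q * c u powr (1 - q))"
    using ac_pos by (intro continuous_intros) force+
  note int = integrable_sphere_measure_continuous[OF cont(1)]
    integrable_sphere_measure_continuous[OF cont(2)] integrable_sphere_measure_continuous[OF this]
  define A where "A = (\<integral>u. a u \<partial>?S)"
  define C where "C = (\<integral>u. c u \<partial>?S)"
  define I where "I = (\<integral>u. a u powr q * c u powr (1 - q) \<partial>?S)"
  have radon: "A powr q * C powr (1 - q) \<le> I"
      "I = A powr q * C powr (1 - q) \<longleftrightarrow> (AE u in ?S. a u = A / C * c u)"
    using Radon_inequality_integral[OF int(1) _ int(2) _ int(3) q emeasure_sphere_measure_space_pos]
    by (auto simp: A_def C_def I_def ac_pos space_sphere_measure)
  have A: "A > 0"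
    unfolding A_def using int(1) emeasure_sphere_measure_space_pos
    by (intro integral_pos) (auto simp: ac_pos space_sphere_measure)
  have C: "C > 0"
    unfolding C_def using int(2) emeasure_sphere_measure_space_pos
    by (intro integral_pos) (auto simp: ac_pos space_sphere_measure)
  define R where "R = A powr q * C powr (1 - q)"
  have R: "R > 0" using A C by (simp add: R_def)
  have I: "I > 0" using R radon(1) by (simp add: R_def)
  have wK: "width_integral i K = A / n" and wL: "width_integral i L = C / n"
    by (simp_all add: width_integral_def A_def C_def a_def c_def m_def n_def)
  have "(\<integral>u. half_width K u powr (real m + p) * half_width L u powr (- p) \<partial>?S) = I"
    unfolding I_def
    by (intro Bochner_Integration.integral_cong) (auto simp: ac_powr space_sphere_measure)
  then have wM: "Lp_mixed_width_integral p i K L = I / n"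
    by (simp add: Lp_mixed_width_integral_def mr n_def)
  have "R ^ m = A powr (real m + p) * C powr (- p)"
    using A C mq by (simp add: R_def power_mult_distrib powr_power mult.commute)
  \<comment> \<open>The factors \<open>1 / n\<close> balance: the exponents
    \<open>real m + p\<close> and \<open>- p\<close> add up to \<open>m\<close>, the power of
    \<open>1 / n\<close> in \<open>(I / n) ^ m\<close>.\<close>
  moreover have "n powr (real m + p) * n powr (- p) = n ^ m"
    using n by (simp add: powr_realpow flip: powr_add)
  ultimately have rhs: "width_integral i K powr (real DIM('a) - real i + p)
      * width_integral i L powr (- p) = (R / n) ^ m"
    using A C n unfolding wK wL mr by (simp add: powr_divide power_divide)
  have sim: "similar_width K L \<longleftrightarrow> I = R"
  proof
    assume "similar_width K L"
    then obtain s where s: "s > 0" "\<And>u. u \<in> sphere 0 1 \<Longrightarrow> half_width K u = s * half_width L u"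
      by (auto simp: similar_width_def)
    then have ac: "a u = s ^ m * c u" if "u \<in> sphere 0 1" for u
      using that by (simp add: a_def c_def power_mult_distrib)
    have "A = (\<integral>u. s ^ m * c u \<partial>?S)"
      unfolding A_def
      by (intro Bochner_Integration.integral_cong) (auto simp: ac space_sphere_measure)
    \<comment> \<open>Integration identifies the proportionality factor \<open>s ^ m\<close> with
      the ratio \<open>A / C\<close> in Radon's equality condition.\<close>
    then have "A / C = s ^ m" using C by (simp add: C_def)
    then have "AE u in ?S. a u = A / C * c u"
      using ac by (intro AE_I2) (simp add: space_sphere_measure)
    then show "I = R" using radon(2) by (simp add: R_def)
  next
    assume "I = R"
    then have "AE u in ?S. a u = A / C * c u" using radon(2) by (simp add: R_def)
    then have ac: "a u = A / C * c u" if "u \<in> sphere 0 1" for u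
      using cont that C
      by (intro AE_sphere_measure_continuous_eq[where u = u]) (auto intro!: continuous_intros)
    \<comment> \<open>\<open>A / C\<close> is the factor between the \<open>m\<close>-th powers of
      the half widths, so its \<open>m\<close>-th root is the factor between the half widths
      themselves.\<close>
    define s where "s = root m (A / C)"
    have s: "s > 0" "s ^ m = A / C" using A C m by (auto simp: s_def)
    have "half_width K u = s * half_width L u" if "u \<in> sphere 0 1" for u
    proof (rule power_eq_imp_eq_base[OF _ _ _ m])
      show "half_width K u ^ m = (s * half_width L u) ^ m"
        using ac[OF that] s by (simp add: a_def c_def power_mult_distrib)
    qed (use pos[OF that] s in auto)
    then show "similar_width K L" using s by (auto simp: similar_width_def)
  qed
  have "R / n \<le> I / n" using radon(1) n by (simp add: R_def divide_right_mono)
  then have "(R / n) ^ m \<le> (I / n) ^ m" using R n by (intro power_mono) auto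
  \<comment> \<open>Since \<open>m > 0\<close>, taking \<open>m\<close>-th powers is injective on
    positive reals, so the equality case is unchanged.\<close>
  moreover have "(I / n) ^ m = (R / n) ^ m \<longleftrightarrow> I = R"
    using R I n m by (simp add: power_eq_iff_eq_base)
  ultimately show ?thesis
    unfolding rhs wM sim m_def[symmetric] by simp
qed

end
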